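(* Suppose that $\mathcal E_1,\mathcal E_2,\ldots$ are superexpectations. Let $E\subseteq\Omega$ be an event for which $\overline{\mathbb P}(E)=\underline{\mathbb P}(E)$. Then, for almost all $\omega\in\Omega$, $\overline{\mathbb P}(E\mid\omega^n)=\underline{\mathbb P}(E\mid\omega^n)$ for all $n$, and this common value converges to $\mathbb I_E(\omega)$ as $n\to\infty$.
   Context: Conventions: $\mathbb N=\{1,2,\ldots\}$, $\overline{\mathbb R}=[-\infty,\infty]$, $0\times\infty:=0$ and $\infty+(-\infty):=\infty$; "positive" means $\ge0$. $\mathbb I_E$ denotes the indicator function of $E$. For a non-empty set $X$, an outer probability content on $X$ is a function $\mathcal E:\overline{\mathbb R}^X\to\overline{\mathbb R}$ such that: (1) $f\le g$ implies $\mathcal E(f)\le\mathcal E(g)$; (2) $\mathcal E(cf)=c\,\mathcal E(f)$ for all $f$ and $c\in(0,\infty)$; (3) $\mathcal E(f+g)\le\mathcal E(f)+\mathcal E(g)$ for all $f,g$; (4) $\mathcal E(c)=c$ for every $c\in\mathbb R$ (the argument being the constant function $c$). It is a superexpectation if, in addition, (5) $\mathcal E(\sum_{k=1}^\infty f_k)\le\sum_{k=1}^\infty\mathcal E(f_k)$ for every sequence of positive functions $f_1,f_2,\ldots\in\overline{\mathbb R}^X$. Setting: a non-empty set $\mathcal X$ and outer probability contents $\mathcal E_1,\mathcal E_2,\ldots$ on $\mathcal X$ are fixed. The sample space is $\Omega:=\mathcal X^\infty$ (infinite sequences); events are subsets of $\Omega$; situations are elements of $\mathcal X^*:=\bigcup_{n\ge0}\mathcal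 X^n$; $\Box$ is the empty situation. For a situation $s$, $\Gamma(s)\subseteq\Omega$ is the set of infinite sequences having $s$ as a prefix; $sx$ is $s$ with $x\in\mathcal X$ appended. For $\omega\in\Omega$ and $n\ge0$, $\omega^n$ is the prefix of $\omega$ of length $n$. A supermartingale is a function $\mathcal S:\mathcal X^*\to\overline{\mathbb R}$ such that $\mathcal E_n(\mathcal S(s\,\cdot))\le\mathcal S(s)$ for all $n\in\mathbb N$ and $s\in\mathcal X^{n-1}$, where $\mathcal S(s\,\cdot)$ is the function $x\mapsto\mathcal S(sx)$. It is bounded below if $\inf\mathcal S>-\infty$. For $\xi:\Omega\to\overline{\mathbb R}$ and a situation $s$, the upper expectation is $$\overline{\mathbb E}(\xi\mid s):=\inf\bigl\{\mathcal S(s)\bigm|\liminf_{n\to\infty}\mathcal S(\omega^n)\ge\xi(\omega)\text{ for all }\omega\in\Gamma(s)\bigr\},$$ $\mathcal S$ ranging over the supermartingales that are bounded below; the lower expectation is $\underline{\mathbb E}(\xi\mid s):=-\overline{\mathbb E}(-\xi\mid s)$. For $E\subseteq\Omega$, $\overline{\mathbb P}(E\mid s):=\overline{\mathbb E}(\mathbb I_E\mid s)$, $\underline{\mathbb P}(E\mid s):=\underline{\mathbb E}(\mathbb I_E\mid s)$; $\overline{\mathbb P}(E):=\overline{\mathbb P}(E\mid\Box)$ and $\underline{\mathbb P}(E):=\underline{\mathbb P}(E\mid\Box)$. A property $A\subseteq\Omega$ holds for almost all $\omega$ if $\underline{\mathbb P}(A)=1$. *)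

theory Defs
  imports "HOL-Library.Extended_Real" "HOL-Library.Indicator_Function"
begin

text \<open>
  The ground set is the universe of the type variable \<^typ>\<open>'a\<close>. The library conventions for
  \<^typ>\<open>ereal\<close> are the ones needed here: \<^prop>\<open>0 * (\<infinity>::ereal) = 0\<close> and
  \<^prop>\<open>(\<infinity>::ereal) + (- \<infinity>) = \<infinity>\<close>.
\<close>

definition outer_prob_content :: "(('a \<Rightarrow> ereal) \<Rightarrow> ereal) \<Rightarrow> bool" where
  "outer_prob_content \<E> \<longleftrightarrow>
     (\<forall>f g. (\<forall>x. f x \<le> g x) \<longrightarrow> \<E> f \<le> \<E> g) \<and>
     (\<forall>f. \<forall>c::real. 0 < c \<longrightarrow> \<E> (\<lambda>x. ereal c * f x) = ereal c * \<E> f) \<and>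
     (\<forall>f g. \<E> (\<lambda>x. f x + g x) \<le> \<E> f + \<E> g) \<and>
     (\<forall>c::real. \<E> (\<lambda>_. ereal c) = ereal c)"

definition superexpectation :: "(('a \<Rightarrow> ereal) \<Rightarrow> ereal) \<Rightarrow> bool" where
  "superexpectation \<E> \<longleftrightarrow>
     outer_prob_content \<E> \<and>
     (\<forall>f :: nat \<Rightarrow> 'a \<Rightarrow> ereal. (\<forall>k x. 0 \<le> f k x) \<longrightarrow>
        \<E> (\<lambda>x. \<Sum>k. f k x) \<le> (\<Sum>k. \<E> (f k)))"

text \<open>
  Situations are lists, the empty situation being \<^term>\<open>[]\<close>; a sample point
  \<open>\<omega> :: nat \<Rightarrow> 'a\<close> lists its entries as \<open>\<omega> 0, \<omega> 1, \<dots>\<close>.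
\<close>

definition prefix_of :: "(nat \<Rightarrow> 'a) \<Rightarrow> nat \<Rightarrow> 'a list" where
  "prefix_of \<omega> n = map \<omega> [0..<n]"

definition cylinder :: "'a list \<Rightarrow> (nat \<Rightarrow> 'a) set" where
  "cylinder s = {\<omega>. prefix_of \<omega> (length s) = s}"

text \<open>
  The contents are indexed by the positive integers: \<open>\<E> n\<close> governs the \<open>n\<close>-th step, which leads
  from a situation of length \<open>n - 1\<close> to one of length \<open>n\<close>. The value \<open>\<E> 0\<close> is never used.
\<close>

definition supermartingale ::
  "(nat \<Rightarrow> ('a \<Rightarrow> ereal) \<Rightarrow> ereal) \<Rightarrow> ('a list \<Rightarrow> ereal) \<Rightarrow> bool" where
  "supermartingale \<E> S \<longleftrightarrow>
     (\<forall>n\<ge>1. \<forall>s. length s = n - 1 \<longrightarrow> \<E> n (\<lambda>x. S (s @ [x])) \<le> S s)"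

definition bounded_below :: "('a list \<Rightarrow> ereal) \<Rightarrow> bool" where
  "bounded_below S \<longleftrightarrow> (INF s. S s) > - \<infinity>"

definition upper_expectation ::
  "(nat \<Rightarrow> ('a \<Rightarrow> ereal) \<Rightarrow> ereal) \<Rightarrow> ((nat \<Rightarrow> 'a) \<Rightarrow> ereal) \<Rightarrow> 'a list \<Rightarrow> ereal" where
  "upper_expectation \<E> \<xi> s =
     Inf {S s | S. supermartingale \<E> S \<and> bounded_below S \<and>
       (\<forall>\<omega>\<in>cylinder s. liminf (\<lambda>n. S (prefix_of \<omega> n)) \<ge> \<xi> \<omega>)}"

definition lower_expectation ::
  "(nat \<Rightarrow> ('a \<Rightarrow> ereal) \<Rightarrow> ereal) \<Rightarrow> ((nat \<Rightarrow> 'a) \<Rightarrow> ereal) \<Rightarrow> 'a list \<Rightarrow> ereal" where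
  "lower_expectation \<E> \<xi> s = - upper_expectation \<E> (\<lambda>\<omega>. - \<xi> \<omega>) s"

definition upper_prob ::
  "(nat \<Rightarrow> ('a \<Rightarrow> ereal) \<Rightarrow> ereal) \<Rightarrow> (nat \<Rightarrow> 'a) set \<Rightarrow> 'a list \<Rightarrow> ereal" where
  "upper_prob \<E> A s = upper_expectation \<E> (indicator A) s"

definition lower_prob ::
  "(nat \<Rightarrow> ('a \<Rightarrow> ereal) \<Rightarrow> ereal) \<Rightarrow> (nat \<Rightarrow> 'a) set \<Rightarrow> 'a list \<Rightarrow> ereal" where
  "lower_prob \<E> A s = lower_expectation \<E> (indicator A) s"

definition almost_all ::
  "(nat \<Rightarrow> ('a \<Rightarrow> ereal) \<Rightarrow> ereal) \<Rightarrow> ((nat \<Rightarrow> 'a) \<Rightarrow> bool) \<Rightarrow> bool" where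
  "almost_all \<E> P \<longleftrightarrow> lower_prob \<E> {\<omega>. P \<omega>} [] = 1"

end

theory Submission
  imports Defs
begin

text \<open>
  Superhedge the indicator of \<open>E\<close> and its negation by supermartingales \<open>A\<^sub>k\<close> and \<open>B\<^sub>k\<close> whose
  initial values sum to at most \<open>2 / 4\<^sup>k\<^sup>+\<^sup>1\<close>; the hypothesis on \<open>E\<close> makes this possible.
  Their sum \<open>M\<^sub>k\<close> has nonnegative lower limits, hence is nonnegative in every situation, and
  bounds the gap between upper and lower probability there. The supermartingale
  \<open>N = \<Sum>\<^sub>k 2\<^sup>k M\<^sub>k\<close> starts at no more than 1, so by Ville's inequality it is bounded along almost
  every path. If \<open>N \<le> C\<close> along a path then \<open>M\<^sub>k \<le> C / 2\<^sup>k\<close> along it, uniformly in time: the gap is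
  zero, and the lower limits of \<open>A\<^sub>k\<close> and \<open>B\<^sub>k\<close> pin the common value to the indicator. The uniformity
  in time makes Doob's convergence theorem unnecessary.
\<close>

section \<open>Paths, one-step functionals and supermartingales\<close>

lemma prefix_of_0 [simp]: "prefix_of \<omega> 0 = []"
  by (simp add: prefix_of_def)

lemma prefix_of_Suc: "prefix_of \<omega> (Suc n) = prefix_of \<omega> n @ [\<omega> n]"
  by (simp add: prefix_of_def)

lemma length_prefix_of [simp]: "length (prefix_of \<omega> n) = n"
  by (simp add: prefix_of_def)

lemma take_prefix_of: "m \<le> n \<Longrightarrow> take m (prefix_of \<omega> n) = prefix_of \<omega> m"
  by (simp add: prefix_of_def take_map)

lemma superexpectation_imp_outer_prob_content:
  "superexpectation \<E> \<Longrightarrow> outer_prob_content \<E>"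
  by (simp add: superexpectation_def)

lemma outer_prob_content_mono:
  "outer_prob_content \<E> \<Longrightarrow> (\<And>x. f x \<le> g x) \<Longrightarrow> \<E> f \<le> \<E> g"
  by (simp add: outer_prob_content_def)

lemma outer_prob_content_cmult:
  "outer_prob_content \<E> \<Longrightarrow> 0 < c \<Longrightarrow> \<E> (\<lambda>x. ereal c * f x) = ereal c * \<E> f"
  by (simp add: outer_prob_content_def)

lemma outer_prob_content_add:
  "outer_prob_content \<E> \<Longrightarrow> \<E> (\<lambda>x. f x + g x) \<le> \<E> f + \<E> g"
  by (simp add: outer_prob_content_def)

lemma outer_prob_content_const:
  "outer_prob_content \<E> \<Longrightarrow> \<E> (\<lambda>_. ereal c) = ereal c"
  by (simp add: outer_prob_content_def)

lemma superexpectation_suminf: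
  "superexpectation \<E> \<Longrightarrow> (\<And>k x. 0 \<le> f k x) \<Longrightarrow> \<E> (\<lambda>x. \<Sum>k. f k x) \<le> (\<Sum>k. \<E> (f k))"
  by (simp add: superexpectation_def)

text \<open>The length of \<open>s\<close> determines the step index, so one quantifier suffices and
  the truncated subtraction \<open>n - 1\<close> disappears.\<close>

lemma supermartingale_iff:
  "supermartingale \<E> S \<longleftrightarrow> (\<forall>s. \<E> (Suc (length s)) (\<lambda>x. S (s @ [x])) \<le> S s)"
proof
  show "supermartingale \<E> S \<Longrightarrow> \<forall>s. \<E> (Suc (length s)) (\<lambda>x. S (s @ [x])) \<le> S s"
    unfolding supermartingale_def by (metis One_nat_def diff_Suc_1 le_add1 plus_1_eq_Suc)
next
  show "\<forall>s. \<E> (Suc (length s)) (\<lambda>x. S (s @ [x])) \<le> S s \<Longrightarrow> supermartingale \<E> S"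
    unfolding supermartingale_def by (metis Suc_pred' less_eq_Suc_le One_nat_def)
qed

lemma bounded_belowI:
  assumes "\<And>s. ereal c \<le> S s"
  shows "bounded_below S"
proof -
  have "ereal c \<le> (INF s. S s)"
    using assms by (rule INF_greatest)
  then show ?thesis
    unfolding bounded_below_def by (metis MInfty_neq_ereal(1) ereal_infty_less(2) ereal_infty_less_eq(2))
qed

section \<open>Lower limits of extended real sequences\<close>

lemma ereal_le_liminf_add:
  fixes f g :: "nat \<Rightarrow> ereal"
  assumes "ereal a \<le> liminf f" "ereal b \<le> liminf g"
  shows "ereal (a + b) \<le> liminf (\<lambda>n. f n + g n)"
proof (rule ereal_le_epsilon2)
  fix e :: real assume e: "0 < e"
  \<comment> \<open>Because \<open>a\<close> and \<open>b\<close> are real, both sequences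
    eventually exceed real numbers, so no clash of infinities can arise in the sum. Each summand
    gets half of the slack \<open>e\<close>.\<close>
  then have "ereal (a - e / 2) < ereal a" "ereal (b - e / 2) < ereal b" by simp_all
  with assms have "eventually (\<lambda>n. ereal (a - e / 2) < f n) sequentially"
    "eventually (\<lambda>n. ereal (b - e / 2) < g n) sequentially"
    unfolding le_Liminf_iff by blast+
  then have "eventually (\<lambda>n. ereal (a + b - e) \<le> f n + g n) sequentially"
  proof eventually_elim
    case (elim n)
    then have "ereal (a - e / 2) + ereal (b - e / 2) \<le> f n + g n"
      by (intro add_mono less_imp_le)
    then show ?case by simp
  qed
  then have "ereal (a + b - e) \<le> liminf (\<lambda>n. f n + g n)"
    by (rule Liminf_bounded)
  then show "ereal (a + b) \<le> liminf (\<lambda>n. f n + g n) + ereal e"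
    by (cases "liminf (\<lambda>n. f n + g n)") auto
qed

lemma tendsto_if_limsup_le_liminf:
  fixes f :: "nat \<Rightarrow> ereal"
  assumes "limsup f \<le> l" "l \<le> liminf f"
  shows "f \<longlonglongrightarrow> l"
  using assms Liminf_le_Limsup[of sequentially f] by (intro Liminf_eq_Limsup) auto

section \<open>Upper expectation as the infimum of superhedging costs\<close>

lemma upper_expectation_le:
  assumes "supermartingale \<E> S" "bounded_below S"
    "\<And>\<omega>. \<omega> \<in> cylinder s \<Longrightarrow> \<xi> \<omega> \<le> liminf (\<lambda>n. S (prefix_of \<omega> n))"
  shows "upper_expectation \<E> \<xi> s \<le> S s"
  unfolding upper_expectation_def using assms by (intro Inf_lower) auto

lemma upper_expectation_ge:
  assumes "\<And>S. supermartingale \<E> S \<Longrightarrow> bounded_below S \<Longrightarrow>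
    (\<And>\<omega>. \<omega> \<in> cylinder s \<Longrightarrow> \<xi> \<omega> \<le> liminf (\<lambda>n. S (prefix_of \<omega> n))) \<Longrightarrow> a \<le> S s"
  shows "a \<le> upper_expectation \<E> \<xi> s"
  unfolding upper_expectation_def using assms by (intro Inf_greatest) auto

lemma upper_expectation_approx:
  assumes "upper_expectation \<E> \<xi> [] < a"
  obtains S where "supermartingale \<E> S" "bounded_below S"
    "\<And>\<omega>. \<xi> \<omega> \<le> liminf (\<lambda>n. S (prefix_of \<omega> n))" "S [] < a"
  using assms unfolding upper_expectation_def Inf_less_iff by (auto simp: cylinder_def)

section \<open>Supermartingales over outer probability contents\<close>

context
  fixes \<E> :: "nat \<Rightarrow> ('a \<Rightarrow> ereal) \<Rightarrow> ereal"
  assumes content: "\<And>n. n \<ge> 1 \<Longrightarrow> outer_prob_content (\<E> n)"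
begin

lemma supermartingale_add:
  assumes "supermartingale \<E> S" "supermartingale \<E> T"
  shows "supermartingale \<E> (\<lambda>s. S s + T s)"
  unfolding supermartingale_iff
proof
  fix s
  have "\<E> (Suc (length s)) (\<lambda>x. S (s @ [x]) + T (s @ [x])) \<le>
      \<E> (Suc (length s)) (\<lambda>x. S (s @ [x])) + \<E> (Suc (length s)) (\<lambda>x. T (s @ [x]))"
    by (intro outer_prob_content_add[OF content]) simp
  also have "\<dots> \<le> S s + T s"
    using assms by (intro add_mono) (simp_all add: supermartingale_iff)
  finally show "\<E> (Suc (length s)) (\<lambda>x. S (s @ [x]) + T (s @ [x])) \<le> S s + T s" .
qed

lemma supermartingale_const: "supermartingale \<E> (\<lambda>_. ereal c)"
  by (simp add: supermartingale_iff outer_prob_content_const content)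

lemma supermartingale_cmult:
  assumes "supermartingale \<E> S" "0 < c"
  shows "supermartingale \<E> (\<lambda>s. ereal c * S s)"
  using assms
  by (simp add: supermartingale_iff outer_prob_content_cmult[OF content] ereal_mult_left_mono)

text \<open>Once the level has been reached the process is frozen at \<open>c\<close>, and contents
  preserve real constants. At the moment of reaching it, any overshoot is cut down to
  \<open>c\<close>; this only lowers the successor values, so monotonicity suffices.\<close>

lemma supermartingale_stopped:
  assumes "supermartingale \<E> S"
  shows "supermartingale \<E> (\<lambda>s. if \<exists>n\<le>length s. ereal c \<le> S (take n s) then ereal c else S s)"
    (is "supermartingale \<E> ?T")
  unfolding supermartingale_iff
proof
  fix s
  show "\<E> (Suc (length s)) (\<lambda>x. ?T (s @ [x])) \<le> ?T s"
  proof (cases "\<exists>n\<le>length s. ereal c \<le> S (take n s)")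
    case True
    then have "?T (s @ [x]) = ereal c" for x
      by (auto intro: le_SucI)
    with True show ?thesis
      by (simp add: outer_prob_content_const content)
  next
    case False
    have "?T (s @ [x]) \<le> S (s @ [x])" for x
    proof (cases "\<exists>n\<le>length (s @ [x]). ereal c \<le> S (take n (s @ [x]))")
      case True
      then obtain n where n: "n \<le> Suc (length s)" "ereal c \<le> S (take n (s @ [x]))"
        by auto
      with False have "n = Suc (length s)"
        by (auto simp: le_Suc_eq)
      with True n show ?thesis by simp
    next
      case False
      then show ?thesis by (simp only: if_False order_refl)
    qed
    then have "\<E> (Suc (length s)) (\<lambda>x. ?T (s @ [x])) \<le> \<E> (Suc (length s)) (\<lambda>x. S (s @ [x]))"
      by (intro outer_prob_content_mono[OF content]) simp_all
    also have "\<dots> \<le> S s"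
      using assms by (simp add: supermartingale_iff)
    finally show ?thesis
      using False by (simp only: if_False)
  qed
qed

text \<open>
  Below a strict bound on \<open>S s\<close>, monotonicity and \<open>\<E> (c) = c\<close> provide a successor with the same
  bound, hence a whole path along which \<open>S\<close> stays below it.
\<close>
lemma supermartingale_ge_liminf:
  assumes S: "supermartingale \<E> S"
    and lim: "\<And>\<omega>. \<omega> \<in> cylinder s \<Longrightarrow> ereal a \<le> liminf (\<lambda>n. S (prefix_of \<omega> n))"
  shows "ereal a \<le> S s"
proof (rule ccontr)
  assume "\<not> ereal a \<le> S s"
  \<comment> \<open>Passing to the limit along the path loses strictness, so a real level strictly
    below \<open>a\<close> is fixed first; being real, it is preserved by the contents.\<close>
  then obtain c where c: "S s < ereal c" "ereal c < ereal a"
    using ereal_dense2[of "S s" "ereal a"] by (auto simp: not_le)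
  have "\<exists>x. S (t @ [x]) < ereal c" if "S t < ereal c" for t
  proof (rule ccontr)
    assume "\<nexists>x. S (t @ [x]) < ereal c"
    then have "\<E> (Suc (length t)) (\<lambda>_. ereal c) \<le> \<E> (Suc (length t)) (\<lambda>x. S (t @ [x]))"
      by (intro outer_prob_content_mono[OF content]) (auto simp: not_less)
    also have "\<dots> \<le> S t"
      using S by (simp add: supermartingale_iff)
    finally show False
      using that by (simp add: outer_prob_content_const content)
  qed
  then obtain x where x: "\<And>t. S t < ereal c \<Longrightarrow> S (t @ [x t]) < ereal c"
    by metis
  \<comment> \<open>\<open>p i\<close> is the situation after \<open>i\<close> steps. It spells out
    \<open>s\<close> first, since nothing is known about \<open>S\<close> at proper prefixes of
    \<open>s\<close>, and only then follows the low successors.\<close>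
  define p where "p = rec_nat [] (\<lambda>i t. t @ [if i < length s then s ! i else x t])"
  have p0: "p 0 = []" and pSuc: "p (Suc i) = p i @ [if i < length s then s ! i else x (p i)]" for i
    by (simp_all add: p_def)
  define \<omega> where "\<omega> i = last (p (Suc i))" for i
  have pre: "prefix_of \<omega> n = p n" for n
    by (induction n) (simp_all add: p0 prefix_of_Suc \<omega>_def pSuc)
  have take: "n \<le> length s \<Longrightarrow> p n = take n s" for n
    by (induction n) (simp_all add: p0 pSuc take_Suc_conv_app_nth)
  have low: "S (p n) < ereal c" if "length s \<le> n" for n
    using that
  proof (induction n rule: dec_induct)
    case base
    then show ?case using c(1) by (simp add: take)
  next
    case (step n)
    then show ?case by (simp add: pSuc x)
  qed
  have "\<omega> \<in> cylinder s"
    by (simp add: cylinder_def pre take)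
  then have "ereal a \<le> liminf (\<lambda>n. S (prefix_of \<omega> n))"
    by (rule lim)
  also have "\<dots> \<le> liminf (\<lambda>n. ereal c)"
    using low by (intro Liminf_mono eventually_sequentiallyI[of "length s"])
      (simp add: pre less_imp_le)
  also have "\<dots> = ereal c"
    by (simp add: Liminf_const)
  finally show False
    using c(2) by simp
qed

text \<open>The two targets cancel on every path through \<open>s\<close>, so the sum is a
  supermartingale whose lower limit there is at least 0, and this bound carries back to
  \<open>s\<close>.\<close>

lemma add_nonneg_if_liminf_ge_indicator:
  assumes S: "supermartingale \<E> S"
      "\<And>\<omega>. \<omega> \<in> cylinder s \<Longrightarrow> indicator A \<omega> \<le> liminf (\<lambda>n. S (prefix_of \<omega> n))"
    and T: "supermartingale \<E> T"
      "\<And>\<omega>. \<omega> \<in> cylinder s \<Longrightarrow> - indicator A \<omega> \<le> liminf (\<lambda>n. T (prefix_of \<omega> n))"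
  shows "0 \<le> S s + T s"
  unfolding zero_ereal_def
proof (rule supermartingale_ge_liminf[OF supermartingale_add[OF S(1) T(1)]])
  fix \<omega> assume \<omega>: "\<omega> \<in> cylinder s"
  have "ereal (indicator A \<omega> + - indicator A \<omega>) \<le>
      liminf (\<lambda>n. S (prefix_of \<omega> n) + T (prefix_of \<omega> n))"
    using S(2)[OF \<omega>] T(2)[OF \<omega>]
    by (intro ereal_le_liminf_add; cases "\<omega> \<in> A") (simp_all add: zero_ereal_def one_ereal_def)
  then show "ereal 0 \<le> liminf (\<lambda>n. S (prefix_of \<omega> n) + T (prefix_of \<omega> n))"
    by simp
qed

section \<open>Lower and upper probability; almost sure boundedness\<close>

lemma lower_prob_le_upper_prob: "lower_prob \<E> A s \<le> upper_prob \<E> A s"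
  unfolding upper_prob_def
proof (rule upper_expectation_ge)
  fix S
  assume S: "supermartingale \<E> S"
    "\<And>\<omega>. \<omega> \<in> cylinder s \<Longrightarrow> indicator A \<omega> \<le> liminf (\<lambda>n. S (prefix_of \<omega> n))"
  have "- S s \<le> upper_expectation \<E> (\<lambda>\<omega>. - indicator A \<omega>) s"
  proof (rule upper_expectation_ge)
    fix T
    assume T: "supermartingale \<E> T"
      "\<And>\<omega>. \<omega> \<in> cylinder s \<Longrightarrow> - indicator A \<omega> \<le> liminf (\<lambda>n. T (prefix_of \<omega> n))"
    from S T have "0 \<le> S s + T s"
      by (rule add_nonneg_if_liminf_ge_indicator)
    \<comment> \<open>The targets are at least -1 and 0 respectively, which keeps both values away
      from \<open>-\<infinity>\<close> when \<open>S s\<close> is moved across the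
      inequality.\<close>
    moreover have "ereal (- 1) \<le> T s"
      by (intro supermartingale_ge_liminf[OF T(1)] order_trans[OF _ T(2)])
        (auto simp: indicator_def one_ereal_def)
    moreover have "ereal 0 \<le> S s"
      by (intro supermartingale_ge_liminf[OF S(1)] order_trans[OF _ S(2)])
        (auto simp: indicator_def)
    ultimately show "- S s \<le> T s"
      by (cases "S s"; cases "T s") auto
  qed
  then show "lower_prob \<E> A s \<le> S s"
    unfolding lower_prob_def lower_expectation_def by (metis ereal_uminus_le_reorder)
qed

lemma upper_prob_le_1: "upper_prob \<E> A s \<le> 1"
  unfolding upper_prob_def one_ereal_def
  by (rule upper_expectation_le[OF supermartingale_const bounded_belowI])
    (auto simp: Liminf_const indicator_def one_ereal_def)

lemma lower_prob_nonneg: "0 \<le> lower_prob \<E> A s"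
proof -
  have "upper_expectation \<E> (\<lambda>\<omega>. - indicator A \<omega>) s \<le> ereal 0"
    by (rule upper_expectation_le[OF supermartingale_const bounded_belowI])
      (auto simp: Liminf_const indicator_def zero_ereal_def one_ereal_def)
  then show ?thesis
    by (simp add: lower_prob_def lower_expectation_def zero_ereal_def[symmetric])
qed

text \<open>
  Ville's inequality: \<open>c N\<close>, stopped on reaching 1, superhedges at cost \<open>c\<close> the event that \<open>N\<close> is
  unbounded.
\<close>
lemma almost_all_bounded:
  assumes N: "supermartingale \<E> N" "\<And>s. 0 \<le> N s" "N [] \<le> 1"
    and P: "\<And>\<omega> C. (\<And>n. N (prefix_of \<omega> n) \<le> ereal C) \<Longrightarrow> P \<omega>"
  shows "almost_all \<E> P"
proof -
  let ?A = "{\<omega>. P \<omega>}"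
  \<comment> \<open>The target is -1 plus the indicator of the complement of \<open>?A\<close>. It
    is hedged by the constant -1 plus a nonnegative process that settles at 1 on every path outside
    \<open>?A\<close>.\<close>
  have bound: "upper_expectation \<E> (\<lambda>\<omega>. - indicator ?A \<omega>) [] \<le> ereal (- 1) + ereal c"
    if c: "0 < c" "c < 1" for c
  proof -
    define N' where "N' s = ereal c * N s" for s
    define T where "T s = (if \<exists>n\<le>length s. ereal 1 \<le> N' (take n s) then ereal 1 else N' s)" for s
    have T: "supermartingale \<E> T"
      unfolding T_def N'_def
      by (intro supermartingale_stopped supermartingale_cmult N c)
    have T0: "0 \<le> T s" for s
      using N(2) c by (auto simp: T_def N'_def)
    have N'0: "N' [] \<le> ereal c"
      using N(3) c ereal_mult_left_mono[of "N []" 1 "ereal c"] by (simp add: N'_def)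
    \<comment> \<open>Here \<open>c < 1\<close> matters: the process is not already stopped at the
      root, so \<open>T []\<close> equals \<open>N' []\<close>.\<close>
    with c have "N' [] < 1"
      by (metis ereal_less(3) order_le_less_trans)
    then have "T [] \<le> ereal c"
      using N'0 by (simp add: T_def one_ereal_def not_le[symmetric])
    have "upper_expectation \<E> (\<lambda>\<omega>. - indicator ?A \<omega>) [] \<le> ereal (- 1) + T []"
    proof (rule upper_expectation_le[OF supermartingale_add[OF supermartingale_const T]])
      show "bounded_below (\<lambda>s. ereal (- 1) + T s)"
        using T0 add_mono[of "ereal (-1)" "ereal (-1)" 0] by (intro bounded_belowI[of "- 1"]) simp
    next
      fix \<omega>
      show "- indicator ?A \<omega> \<le> liminf (\<lambda>n. ereal (- 1) + T (prefix_of \<omega> n))"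
      proof (cases "P \<omega>")
        case True
        have "ereal (- 1 + 0) \<le> liminf (\<lambda>n. ereal (- 1) + T (prefix_of \<omega> n))"
          using T0 by (intro ereal_le_liminf_add Liminf_bounded) (auto simp: zero_ereal_def[symmetric])
        with True show ?thesis
          by (simp add: one_ereal_def)
      next
        case False
        \<comment> \<open>Contraposition of \<open>P\<close> at the level \<open>1 / c\<close>,
          which scaling by \<open>c\<close> turns into the stopping level 1.\<close>
        then obtain m where "\<not> N (prefix_of \<omega> m) \<le> ereal (1 / c)"
          using P by blast
        then have "ereal c * ereal (1 / c) \<le> N' (prefix_of \<omega> m)"
          using c unfolding N'_def by (intro ereal_mult_left_mono) auto
        then have m: "ereal 1 \<le> N' (prefix_of \<omega> m)"
          using c by simp
        have "T (prefix_of \<omega> n) = ereal 1" if "m \<le> n" for n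
          using that m take_prefix_of[OF that, of \<omega>] by (auto simp: T_def)
        then have "ereal 1 \<le> liminf (\<lambda>n. T (prefix_of \<omega> n))"
          by (intro Liminf_bounded eventually_sequentiallyI[of m]) simp
        then have "ereal (- 1 + 1) \<le> liminf (\<lambda>n. ereal (- 1) + T (prefix_of \<omega> n))"
          by (intro ereal_le_liminf_add) (simp_all add: Liminf_const)
        with False show ?thesis by (simp add: zero_ereal_def)
      qed
    qed
    also have "\<dots> \<le> ereal (- 1) + ereal c"
      using \<open>T [] \<le> ereal c\<close> by (rule add_left_mono)
    finally show ?thesis .
  qed
  have "upper_expectation \<E> (\<lambda>\<omega>. - indicator ?A \<omega>) [] \<le> ereal (- 1)"
  proof (rule ereal_le_epsilon2)
    fix e :: real assume "0 < e"
    then have "upper_expectation \<E> (\<lambda>\<omega>. - indicator ?A \<omega>) [] \<le> ereal (- 1) + ereal (min e (1 / 2))"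
      by (intro bound) auto
    also have "\<dots> \<le> ereal (- 1) + ereal e" by (intro add_left_mono) simp
    finally show "upper_expectation \<E> (\<lambda>\<omega>. - indicator ?A \<omega>) [] \<le> ereal (- 1) + ereal e" .
  qed
  then have "1 \<le> lower_prob \<E> ?A []"
    unfolding lower_prob_def lower_expectation_def
    by (cases "upper_expectation \<E> (\<lambda>\<omega>. - indicator ?A \<omega>) []") (auto simp: one_ereal_def)
  moreover have "lower_prob \<E> ?A [] \<le> 1"
    using lower_prob_le_upper_prob upper_prob_le_1 by (rule order_trans)
  ultimately show ?thesis
    unfolding almost_all_def by (rule antisym[rotated])
qed

end

lemma supermartingale_suminf:
  fixes \<E> :: "nat \<Rightarrow> ('a \<Rightarrow> ereal) \<Rightarrow> ereal"
  assumes "\<And>n. n \<ge> 1 \<Longrightarrow> superexpectation (\<E> n)"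
    and "\<And>k. supermartingale \<E> (S k)" "\<And>k s. 0 \<le> S k s"
  shows "supermartingale \<E> (\<lambda>s. \<Sum>k. S k s)"
  unfolding supermartingale_iff
proof
  fix s :: "'a list"
  let ?\<E> = "\<E> (Suc (length s))"
  have sup: "superexpectation ?\<E>" using assms(1) by simp
  note content = superexpectation_imp_outer_prob_content[OF sup]
  \<comment> \<open>Monotonicity against the zero function; this makes the series of one-step values
    converge, so that it can be compared termwise.\<close>
  have nonneg: "0 \<le> ?\<E> (\<lambda>x. S k (s @ [x]))" for k
    using outer_prob_content_mono[OF content, of "\<lambda>_. ereal 0" "\<lambda>x. S k (s @ [x])"] assms(3)
    by (simp add: outer_prob_content_const[OF content, of 0] zero_ereal_def)
  \<comment> \<open>Countable subadditivity, the property that distinguishes superexpectations from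
    outer probability contents, enters here.\<close>
  have "?\<E> (\<lambda>x. \<Sum>k. S k (s @ [x])) \<le> (\<Sum>k. ?\<E> (\<lambda>x. S k (s @ [x])))"
    using sup assms(3) by (rule superexpectation_suminf)
  also have "\<dots> \<le> (\<Sum>k. S k s)"
    using assms(2,3) nonneg by (intro suminf_le summable_ereal_pos) (auto simp: supermartingale_iff)
  finally show "?\<E> (\<lambda>x. \<Sum>k. S k (s @ [x])) \<le> (\<Sum>k. S k s)" .
qed

section \<open>Merging of upper and lower probability, and the zero-one limit\<close>

theorem corollary4:
  fixes \<E> :: "nat \<Rightarrow> ('a \<Rightarrow> ereal) \<Rightarrow> ereal"
    and E :: "(nat \<Rightarrow> 'a) set"
  assumes "\<And>n. n \<ge> 1 \<Longrightarrow> superexpectation (\<E> n)"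
    and "upper_prob \<E> E [] = lower_prob \<E> E []"
  shows "almost_all \<E> (\<lambda>\<omega>.
           (\<forall>n. upper_prob \<E> E (prefix_of \<omega> n) = lower_prob \<E> E (prefix_of \<omega> n)) \<and>
           (\<lambda>n. upper_prob \<E> E (prefix_of \<omega> n)) \<longlonglongrightarrow> indicator E \<omega>)"
proof -
  have content: "\<And>n. n \<ge> 1 \<Longrightarrow> outer_prob_content (\<E> n)"
    using assms(1) by (rule superexpectation_imp_outer_prob_content)
  note bounds = lower_prob_nonneg[where \<E> = \<E>, OF content]
    lower_prob_le_upper_prob[where \<E> = \<E>, OF content] upper_prob_le_1[where \<E> = \<E>, OF content]
  obtain a where a: "upper_prob \<E> E [] = ereal a"
    using bounds(1,3)[where A = E and s = "[]"] unfolding assms(2)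
    by (cases "lower_prob \<E> E []") auto
  \<comment> \<open>The hypothesis on \<open>E\<close> enters here: the costs of the two targets
    cancel, leaving only the approximation errors in the sum of the hedges.\<close>
  have a': "upper_expectation \<E> (\<lambda>\<omega>. - indicator E \<omega>) [] = ereal (- a)"
    using a assms(2) unfolding lower_prob_def lower_expectation_def
    by (cases "upper_expectation \<E> (\<lambda>\<omega>. - indicator E \<omega>) []") auto
  \<comment> \<open>Chosen so that the weighted initial cost \<open>2 ^ k * (2 * \<delta> k)\<close>
    is \<open>(1 / 2) ^ Suc k\<close>, a series with sum 1, although the weights grow without
    bound.\<close>
  define \<delta> :: "nat \<Rightarrow> real" where "\<delta> k = (1 / 4) ^ Suc k" for k
  have \<delta>: "0 < \<delta> k" for k by (simp add: \<delta>_def)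
  have "\<exists>S. supermartingale \<E> S \<and> bounded_below S \<and>
      (\<forall>\<omega>. indicator E \<omega> \<le> liminf (\<lambda>n. S (prefix_of \<omega> n))) \<and> S [] < ereal (a + \<delta> k)" for k
    using a \<delta>[of k] unfolding upper_prob_def
    by (metis upper_expectation_approx less_add_same_cancel1 less_ereal.simps(1))
  then obtain A where A: "\<And>k. supermartingale \<E> (A k)" "\<And>k. bounded_below (A k)"
    "\<And>k \<omega>. indicator E \<omega> \<le> liminf (\<lambda>n. A k (prefix_of \<omega> n))" "\<And>k. A k [] < ereal (a + \<delta> k)"
    by metis
  have "\<exists>S. supermartingale \<E> S \<and> bounded_below S \<and>
      (\<forall>\<omega>. - indicator E \<omega> \<le> liminf (\<lambda>n. S (prefix_of \<omega> n))) \<and> S [] < ereal (- a + \<delta> k)" for k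
    using a' \<delta>[of k] upper_expectation_approx[of \<E> "\<lambda>\<omega>. - indicator E \<omega>" "ereal (- a + \<delta> k)"]
    by (metis less_add_same_cancel1 less_ereal.simps(1))
  then obtain B where B: "\<And>k. supermartingale \<E> (B k)" "\<And>k. bounded_below (B k)"
    "\<And>k \<omega>. - indicator E \<omega> \<le> liminf (\<lambda>n. B k (prefix_of \<omega> n))" "\<And>k. B k [] < ereal (- a + \<delta> k)"
    by metis
  \<comment> \<open>The hedges were selected by their cost at the root, but they dominate along all
    paths and are therefore admissible at every \<open>s\<close>.\<close>
  have A_ge: "upper_prob \<E> E s \<le> A k s" for k s
    unfolding upper_prob_def using A by (intro upper_expectation_le)
  have B_ge: "- lower_prob \<E> E s \<le> B k s" for k s
    unfolding lower_prob_def lower_expectation_def ereal_uminus_uminus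
    using B by (intro upper_expectation_le)
  define M where "M k s = A k s + B k s" for k s
  have M: "supermartingale \<E> (M k)" for k
    unfolding M_def by (intro supermartingale_add content A B)
  have M_nonneg: "0 \<le> M k s" for k s
    unfolding M_def by (rule add_nonneg_if_liminf_ge_indicator[OF content A(1,3) B(1,3)])
  have M_init: "ereal (2 ^ k) * M k [] \<le> (1 / 2) ^ Suc k" for k
  proof -
    have "M k [] \<le> ereal (a + \<delta> k) + ereal (- a + \<delta> k)"
      unfolding M_def using A(4) B(4) by (intro add_mono less_imp_le)
    then have "ereal (2 ^ k) * M k [] \<le> ereal (2 ^ k) * ereal (2 * \<delta> k)"
      by (intro ereal_mult_left_mono) auto
    also have "\<dots> = ereal ((1 / 2) ^ Suc k)"
      using power_mult_distrib[of "2 :: real" 2 k] by (simp add: \<delta>_def power_divide)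
    also have "\<dots> = (1 / 2) ^ Suc k"
      by (simp add: one_ereal_def)
    finally show ?thesis .
  qed
  define N where "N s = (\<Sum>k. ereal (2 ^ k) * M k s)" for s
  have term_nonneg: "0 \<le> ereal (2 ^ k) * M k s" for k s
    using M_nonneg by simp
  show ?thesis
  proof (rule almost_all_bounded[where \<E> = \<E> and N = N, OF content])
    show "supermartingale \<E> N"
      unfolding N_def
      by (intro supermartingale_suminf assms(1) term_nonneg supermartingale_cmult content M) simp_all
    show "0 \<le> N s" for s
      unfolding N_def using term_nonneg by (intro suminf_nonneg summable_ereal_pos)
    have "N [] \<le> (\<Sum>k. (1 / 2 :: ereal) ^ Suc k)"
      unfolding N_def using term_nonneg M_init
      by (intro suminf_le summable_ereal_pos) (auto intro: order_trans)
    then show "N [] \<le> 1"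
      by (simp only: suminf_half_series_ereal)
  next
    fix \<omega> and C :: real
    assume C: "\<And>n. N (prefix_of \<omega> n) \<le> ereal C"
    let ?u = "\<lambda>n. upper_prob \<E> E (prefix_of \<omega> n)"
    let ?l = "\<lambda>n. lower_prob \<E> E (prefix_of \<omega> n)"
    \<comment> \<open>A single term of a nonnegative series is at most its sum.\<close>
    have M_le: "M k (prefix_of \<omega> n) \<le> ereal (C / 2 ^ k)" for k n
    proof -
      have "ereal (2 ^ k) * M k (prefix_of \<omega> n) \<le> N (prefix_of \<omega> n)"
        using sum_le_suminf[of "\<lambda>k. ereal (2 ^ k) * M k (prefix_of \<omega> n)" "{k}"] term_nonneg
        by (simp add: N_def summable_ereal_pos)
      also have "\<dots> \<le> ereal C" by (rule C)
      finally show ?thesis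
        by (cases "M k (prefix_of \<omega> n)") (auto simp: field_simps)
    qed
    have small: "\<exists>k. C / 2 ^ k < e" if "0 < e" for e
    proof -
      obtain k where "C / e < 2 ^ k"
        using real_arch_pow[of 2 "C / e"] by auto
      with that show ?thesis
        by (auto simp: field_simps)
    qed
    \<comment> \<open>By \<open>A_ge\<close> and \<open>B_ge\<close> the gap is at most
      \<open>M k\<close>, for every \<open>k\<close>. Both probabilities lie between 0 and 1, so
      they can be subtracted safely.\<close>
    have gap: "?u n \<le> ?l n" for n
    proof (rule ereal_le_epsilon2)
      fix e :: real assume "0 < e"
      then obtain k where "C / 2 ^ k < e" using small by blast
      with M_le[of k n] have "A k (prefix_of \<omega> n) + B k (prefix_of \<omega> n) \<le> ereal e"
        unfolding M_def by (meson ereal_less_eq(3) less_imp_le order_trans)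
      moreover have "?u n + - ?l n \<le> A k (prefix_of \<omega> n) + B k (prefix_of \<omega> n)"
        by (intro add_mono A_ge B_ge)
      ultimately have "?u n + - ?l n \<le> ereal e" by simp
      then show "?u n \<le> ?l n + ereal e"
        using bounds[where A = E and s = "prefix_of \<omega> n"]
        by (cases "?u n"; cases "?l n") auto
    qed
    have eq: "?u n = ?l n" for n
      using gap bounds(2) by (rule antisym)
    have "?u \<longlonglongrightarrow> indicator E \<omega>"
    proof (cases "\<omega> \<in> E")
      case True
      have "1 \<le> liminf ?u"
      proof (rule ereal_le_epsilon2)
        fix e :: real assume "0 < e"
        then obtain k where k: "C / 2 ^ k < e" using small by blast
        \<comment> \<open>With \<open>eq\<close>, \<open>B k\<close> is at least
          \<open>- ?u n\<close>; removing it from \<open>M k\<close> leaves this bound on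
          \<open>A k\<close>. The index \<open>k\<close> does not depend on \<open>n\<close>, so the
          lower limit can be taken.\<close>
        have "A k (prefix_of \<omega> n) \<le> ?u n + ereal e" for n
          using B_ge[of "prefix_of \<omega> n" k, folded eq] M_le[of k n] k
            bounds(1,3)[where A = E and s = "prefix_of \<omega> n", folded eq]
          unfolding M_def
          by (cases "?u n"; cases "A k (prefix_of \<omega> n)"; cases "B k (prefix_of \<omega> n)") auto
        then have "liminf (\<lambda>n. A k (prefix_of \<omega> n)) \<le> liminf (\<lambda>n. ?u n + ereal e)"
          by (intro Liminf_mono) simp
        also have "\<dots> = liminf ?u + ereal e"
          by (simp add: Liminf_add_ereal_right)
        finally show "1 \<le> liminf ?u + ereal e"
          using A(3)[of \<omega> k] True by simp
      qed
      moreover have "limsup ?u \<le> 1"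
        using bounds(3) by (intro Limsup_bounded) simp
      ultimately have "?u \<longlonglongrightarrow> 1"
        by (rule tendsto_if_limsup_le_liminf[rotated])
      with True show ?thesis by simp
    next
      case False
      \<comment> \<open>Off \<open>E\<close> the roles of \<open>A k\<close> and \<open>B k\<close>
        are exchanged. The lower limit of \<open>B k\<close> is then at least 0, and negation turns
        the resulting bound into one on the upper limit of \<open>?u\<close>.\<close>
      have "0 \<le> liminf (\<lambda>n. - ?u n)"
      proof (rule ereal_le_epsilon2)
        fix e :: real assume "0 < e"
        then obtain k where k: "C / 2 ^ k < e" using small by blast
        have "B k (prefix_of \<omega> n) \<le> - ?u n + ereal e" for n
          using A_ge[of "prefix_of \<omega> n" k] M_le[of k n] k
            bounds[where A = E and s = "prefix_of \<omega> n"]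
          unfolding M_def
          by (cases "?u n"; cases "A k (prefix_of \<omega> n)"; cases "B k (prefix_of \<omega> n)") auto
        then have "liminf (\<lambda>n. B k (prefix_of \<omega> n)) \<le> liminf (\<lambda>n. - ?u n + ereal e)"
          by (intro Liminf_mono) simp
        also have "\<dots> = liminf (\<lambda>n. - ?u n) + ereal e"
          by (simp add: Liminf_add_ereal_right)
        finally show "0 \<le> liminf (\<lambda>n. - ?u n) + ereal e"
          using B(3)[of \<omega> k] False by simp
      qed
      then have "limsup ?u \<le> 0"
        by (simp add: ereal_Liminf_uminus)
      moreover have "0 \<le> liminf ?u"
        using order_trans[OF bounds(1,2)] by (intro Liminf_bounded) simp
      ultimately have "?u \<longlonglongrightarrow> 0"
        by (rule tendsto_if_limsup_le_liminf)
      with False show ?thesis by simp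
    qed
    with eq show "(\<forall>n. ?u n = ?l n) \<and> ?u \<longlonglongrightarrow> indicator E \<omega>"
      by simp
  qed
qed

end
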